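(* A pseudo BCK-algebra $A$ is commutative if and only if $\{1\}$ is a commutative deductive system of $A$.
   Context: A pseudo BCK-algebra is an algebra $(A,\rightarrow,\rightsquigarrow,1)$ of type $(2,2,0)$ such that for all $x,y,z\in A$: $(x\rightarrow y)\rightsquigarrow[(y\rightarrow z)\rightsquigarrow(x\rightarrow z)]=1$; $(x\rightsquigarrow y)\rightarrow[(y\rightsquigarrow z)\rightarrow(x\rightsquigarrow z)]=1$; $1\rightarrow x=x$; $1\rightsquigarrow x=x$; $x\rightarrow 1=1$; and if $x\rightarrow y=1$ and $y\rightarrow x=1$ then $x=y$. The order is $x\le y$ iff $x\rightarrow y=1$ (iff $x\rightsquigarrow y=1$). $A$ is commutative if $(x\rightarrow y)\rightsquigarrow y=(y\rightarrow x)\rightsquigarrow x$ and $(x\rightsquigarrow y)\rightarrow y=(y\rightsquigarrow x)\rightarrow x$ for all $x,y$. A deductive system of $A$ is a subset $D\subseteq A$ with $1\in D$ such that $x\in D$ and $x\rightarrow y\in D$ imply $y\in D$. A deductive system $D$ is commutative if for all $x,y\in A$: $y\rightarrow x\in D$ implies $((x\rightarrow y)\rightsquigarrow y)\rightarrow x\in D$, and $y\rightsquigarrow x\in D$ implies $((x\rightsquigarrow y)\rightarrow y)\rightsquigarrow x\in D$. *)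

theory Defs
  imports Main
begin

text \<open>The algebra is given by an explicit carrier \<open>A\<close>; the operations need only be
  well behaved on \<open>A\<close>, so all axioms are relativised to it.\<close>

locale pseudo_BCK =
  fixes A :: "'a set"
    and imp :: "'a \<Rightarrow> 'a \<Rightarrow> 'a"  (infixr "\<rightarrow>" 65)
    and sqimp :: "'a \<Rightarrow> 'a \<Rightarrow> 'a"  (infixr "\<leadsto>" 65)
    and one :: 'a  ("\<one>")
  assumes imp_closed: "\<lbrakk>x \<in> A; y \<in> A\<rbrakk> \<Longrightarrow> (x \<rightarrow> y) \<in> A"
    and sqimp_closed: "\<lbrakk>x \<in> A; y \<in> A\<rbrakk> \<Longrightarrow> (x \<leadsto> y) \<in> A"
    and one_closed: "\<one> \<in> A"
    and imp_trans: "\<lbrakk>x \<in> A; y \<in> A; z \<in> A\<rbrakk> \<Longrightarrow> (x \<rightarrow> y) \<leadsto> ((y \<rightarrow> z) \<leadsto> (x \<rightarrow> z)) = \<one>"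
    and sqimp_trans: "\<lbrakk>x \<in> A; y \<in> A; z \<in> A\<rbrakk> \<Longrightarrow> (x \<leadsto> y) \<rightarrow> ((y \<leadsto> z) \<rightarrow> (x \<leadsto> z)) = \<one>"
    and one_imp: "x \<in> A \<Longrightarrow> (\<one> \<rightarrow> x) = x"
    and one_sqimp: "x \<in> A \<Longrightarrow> (\<one> \<leadsto> x) = x"
    and imp_one: "x \<in> A \<Longrightarrow> (x \<rightarrow> \<one>) = \<one>"
    and imp_antisym: "\<lbrakk>x \<in> A; y \<in> A; (x \<rightarrow> y) = \<one>; (y \<rightarrow> x) = \<one>\<rbrakk> \<Longrightarrow> x = y"

definition commutative_pseudo_BCK ::
  "'a set \<Rightarrow> ('a \<Rightarrow> 'a \<Rightarrow> 'a) \<Rightarrow> ('a \<Rightarrow> 'a \<Rightarrow> 'a) \<Rightarrow> 'a \<Rightarrow> bool" where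
  "commutative_pseudo_BCK A imp sqimp one \<longleftrightarrow>
     pseudo_BCK A imp sqimp one \<and>
     (\<forall>x\<in>A. \<forall>y\<in>A. sqimp (imp x y) y = sqimp (imp y x) x \<and>
                    imp (sqimp x y) y = imp (sqimp y x) x)"

definition deductive_system :: "'a set \<Rightarrow> ('a \<Rightarrow> 'a \<Rightarrow> 'a) \<Rightarrow> 'a \<Rightarrow> 'a set \<Rightarrow> bool" where
  "deductive_system A imp one D \<longleftrightarrow>
     D \<subseteq> A \<and> one \<in> D \<and> (\<forall>x\<in>A. \<forall>y\<in>A. x \<in> D \<longrightarrow> imp x y \<in> D \<longrightarrow> y \<in> D)"

definition commutative_deductive_system ::
  "'a set \<Rightarrow> ('a \<Rightarrow> 'a \<Rightarrow> 'a) \<Rightarrow> ('a \<Rightarrow> 'a \<Rightarrow> 'a) \<Rightarrow> 'a \<Rightarrow> 'a set \<Rightarrow> bool" where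
  "commutative_deductive_system A imp sqimp one D \<longleftrightarrow>
     deductive_system A imp one D \<and>
     (\<forall>x\<in>A. \<forall>y\<in>A. (imp y x \<in> D \<longrightarrow> imp (sqimp (imp x y) y) x \<in> D) \<and>
                    (sqimp y x \<in> D \<longrightarrow> sqimp (imp (sqimp x y) y) x \<in> D))"

end

theory Submission
  imports Defs
begin

text \<open>
  Write \<open>u = (x \<rightarrow> y) \<leadsto> y\<close> and \<open>v = (y \<rightarrow> x) \<leadsto> x\<close>; both are upper bounds of \<open>x\<close> and \<open>y\<close>.
  Commutativity of \<open>{\<one>}\<close> says that \<open>(w \<rightarrow> y) \<leadsto> y = w\<close> whenever \<open>y \<le> w\<close>. Since \<open>x \<mapsto> (x \<rightarrow> y) \<leadsto> y\<close>
  is monotone, \<open>x \<le> v\<close> gives \<open>u \<le> (v \<rightarrow> y) \<leadsto> y = v\<close>, and by symmetry \<open>u = v\<close>. The other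
  identity follows by exchanging the two implications.
\<close>

context pseudo_BCK
begin

lemma imp_refl: "x \<in> A \<Longrightarrow> x \<rightarrow> x = \<one>"
  using sqimp_trans[of \<one> \<one> x] by (simp add: one_closed imp_closed one_imp one_sqimp)

lemma le_imp_sqimp: "\<lbrakk>x \<in> A; y \<in> A\<rbrakk> \<Longrightarrow> x \<leadsto> ((x \<rightarrow> y) \<leadsto> y) = \<one>"
  using imp_trans[of \<one> x y] by (simp add: one_closed one_imp)

lemma le_sqimp_imp: "\<lbrakk>x \<in> A; y \<in> A\<rbrakk> \<Longrightarrow> x \<rightarrow> ((x \<leadsto> y) \<rightarrow> y) = \<one>"
  using sqimp_trans[of \<one> x y] by (simp add: one_closed one_sqimp)

text \<open>If \<open>x \<rightarrow> y = \<one>\<close>, then \<open>le_imp_sqimp\<close> reads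
  \<open>x \<leadsto> (\<one> \<leadsto> y) = \<one>\<close>, and the unit law removes the inner
  \<open>\<one>\<close>; the converse uses \<open>le_sqimp_imp\<close>.\<close>

lemma imp_eq_one_iff_sqimp_eq_one:
  "\<lbrakk>x \<in> A; y \<in> A\<rbrakk> \<Longrightarrow> x \<rightarrow> y = \<one> \<longleftrightarrow> x \<leadsto> y = \<one>"
  using le_imp_sqimp[of x y] le_sqimp_imp[of x y] by (metis one_imp one_sqimp)

text \<open>Exchanging the implications permutes the other axioms; only \<open>imp_one\<close> and
  \<open>imp_antisym\<close> are one-sided, and they transfer because both implications define the
  same order. Facts about \<open>pseudo_BCK\<close> thus have mirror images.\<close>

lemma dual_pseudo_BCK: "pseudo_BCK A (\<leadsto>) (\<rightarrow>) \<one>"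
proof
  show "x \<leadsto> \<one> = \<one>" if "x \<in> A" for x
    using that imp_eq_one_iff_sqimp_eq_one[of x \<one>] by (simp add: one_closed imp_one)
  show "x = y" if "x \<in> A" "y \<in> A" "x \<leadsto> y = \<one>" "y \<leadsto> x = \<one>" for x y
    using that imp_eq_one_iff_sqimp_eq_one imp_antisym by metis
qed (fact imp_closed sqimp_closed one_closed imp_trans sqimp_trans one_imp one_sqimp)+

lemma imp_antimono:
  "\<lbrakk>x \<in> A; y \<in> A; z \<in> A; x \<rightarrow> y = \<one>\<rbrakk> \<Longrightarrow> (y \<rightarrow> z) \<rightarrow> (x \<rightarrow> z) = \<one>"
  using imp_trans[of x y z] imp_eq_one_iff_sqimp_eq_one[of "y \<rightarrow> z" "x \<rightarrow> z"]
  by (simp add: one_sqimp imp_closed sqimp_closed)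

lemma sqimp_antimono:
  "\<lbrakk>x \<in> A; y \<in> A; z \<in> A; x \<rightarrow> y = \<one>\<rbrakk> \<Longrightarrow> (y \<leadsto> z) \<rightarrow> (x \<leadsto> z) = \<one>"
  using pseudo_BCK.imp_antimono[OF dual_pseudo_BCK, of x y z]
  by (simp add: sqimp_closed imp_eq_one_iff_sqimp_eq_one)

text \<open>Since \<open>x \<leadsto> \<one> = \<one>\<close>, \<open>sqimp_trans\<close> with
  middle term \<open>\<one>\<close> reduces to the claim.\<close>

lemma le_sqimp: "\<lbrakk>x \<in> A; y \<in> A\<rbrakk> \<Longrightarrow> y \<rightarrow> (x \<leadsto> y) = \<one>"
  using sqimp_trans[of x \<one> y] imp_eq_one_iff_sqimp_eq_one[of x \<one>]
  by (simp add: one_closed imp_closed sqimp_closed one_imp one_sqimp imp_one)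

lemma join_le_join:
  assumes com: "\<And>x y. \<lbrakk>x \<in> A; y \<in> A; y \<rightarrow> x = \<one>\<rbrakk> \<Longrightarrow> ((x \<rightarrow> y) \<leadsto> y) \<rightarrow> x = \<one>"
    and x: "x \<in> A" and y: "y \<in> A"
  shows "((x \<rightarrow> y) \<leadsto> y) \<rightarrow> ((y \<rightarrow> x) \<leadsto> x) = \<one>"
proof -
  define v where "v = (y \<rightarrow> x) \<leadsto> x"
  have v: "v \<in> A" by (simp add: v_def x y imp_closed sqimp_closed)
  have "x \<rightarrow> v = \<one>" by (simp add: v_def x y imp_closed le_sqimp)
  \<comment> \<open>Two antitone maps compose to a monotone one: \<open>x \<le> v\<close> gives
    \<open>v \<rightarrow> y \<le> x \<rightarrow> y\<close>, and applying
    \<open>\<leadsto> y\<close> reverses the order again.\<close>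
  then have mono: "((x \<rightarrow> y) \<leadsto> y) \<rightarrow> ((v \<rightarrow> y) \<leadsto> y) = \<one>"
    by (simp add: x y v imp_closed imp_antimono sqimp_antimono)
  have "y \<rightarrow> v = \<one>"
    by (simp add: v_def x y imp_closed sqimp_closed le_imp_sqimp imp_eq_one_iff_sqimp_eq_one)
  \<comment> \<open>The first inequality is \<open>com\<close> with \<open>v\<close> in the role of
    \<open>x\<close>; the second holds for all elements.\<close>
  then have "((v \<rightarrow> y) \<leadsto> y) \<rightarrow> v = \<one>" "v \<rightarrow> ((v \<rightarrow> y) \<leadsto> y) = \<one>"
    using le_imp_sqimp[of v y]
    by (simp_all add: com v y imp_closed sqimp_closed imp_eq_one_iff_sqimp_eq_one)
  then have "(v \<rightarrow> y) \<leadsto> y = v"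
    by (rule imp_antisym[rotated 2]) (simp_all add: v y imp_closed sqimp_closed)
  with mono show ?thesis by (simp add: v_def)
qed

lemma join_commute:
  assumes "\<And>x y. \<lbrakk>x \<in> A; y \<in> A; y \<rightarrow> x = \<one>\<rbrakk> \<Longrightarrow> ((x \<rightarrow> y) \<leadsto> y) \<rightarrow> x = \<one>"
    and "x \<in> A" "y \<in> A"
  shows "(x \<rightarrow> y) \<leadsto> y = (y \<rightarrow> x) \<leadsto> x"
  using assms(2,3)
  by (intro imp_antisym[OF _ _ join_le_join join_le_join] imp_closed sqimp_closed assms(1))

end

theorem theorem4p7:
  fixes A :: "'a set"
    and imp sqimp :: "'a \<Rightarrow> 'a \<Rightarrow> 'a"
    and one :: 'a
  assumes "pseudo_BCK A imp sqimp one"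
  shows "commutative_pseudo_BCK A imp sqimp one \<longleftrightarrow>
         commutative_deductive_system A imp sqimp one {one}"
proof
  interpret pseudo_BCK A imp sqimp one by (fact assms)
  interpret dual: pseudo_BCK A sqimp imp one by (fact dual_pseudo_BCK)
  show "commutative_deductive_system A imp sqimp one {one}"
    if C: "commutative_pseudo_BCK A imp sqimp one"
  proof -
    have comm: "sqimp (imp x y) y = sqimp (imp y x) x" "imp (sqimp x y) y = imp (sqimp y x) x"
      if "x \<in> A" "y \<in> A" for x y
      using C that
      by (simp_all add: commutative_pseudo_BCK_def)
    \<comment> \<open>When \<open>imp y x = one\<close>, commutativity turns
      \<open>sqimp (imp x y) y\<close> into \<open>sqimp one x\<close>, which is
      \<open>x\<close>.\<close>
    have "imp (sqimp (imp x y) y) x = one" if "x \<in> A" "y \<in> A" "imp y x = one" for x y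
      using that comm by (metis one_sqimp imp_refl)
    moreover have "sqimp (imp (sqimp x y) y) x = one"
      if "x \<in> A" "y \<in> A" "sqimp y x = one" for x y
      using that comm by (metis one_imp dual.imp_refl)
    ultimately show ?thesis
      by (simp add: commutative_deductive_system_def deductive_system_def one_closed one_imp)
  qed
  show "commutative_pseudo_BCK A imp sqimp one"
    if D: "commutative_deductive_system A imp sqimp one {one}"
  proof -
    have "imp (sqimp (imp x y) y) x = one" if "x \<in> A" "y \<in> A" "imp y x = one" for x y
      using D that by (simp add: commutative_deductive_system_def)
    moreover have "sqimp (imp (sqimp x y) y) x = one"
      if "x \<in> A" "y \<in> A" "sqimp y x = one" for x y
      using D that by (simp add: commutative_deductive_system_def)
    \<comment> \<open>Each half of the condition on \<open>{one}\<close> is the hypothesis of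
      \<open>join_commute\<close>, in the algebra or in its dual.\<close>
    ultimately show ?thesis
      using assms join_commute dual.join_commute by (simp add: commutative_pseudo_BCK_def)
  qed
qed

end
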